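(* Let $\mathcal{H}$ be a real Hilbert space, $T:\mathcal{H}\rightrightarrows\mathcal{H}$ a set-valued operator, $c:\mathcal{H}\to\mathbb{R}$ a function and $C=\{x\in\mathcal{H}: c(x)\le 0\}$, and suppose that Assumptions (A1)--(A4) of the context hold. Let $x^0\in\mathcal{H}$ be arbitrary and let $(x^k)_{k\ge 0}$ be a sequence generated by the algorithm FSPA described in the context. Then $(x^k)$ converges strongly (in norm) to $\bar x=P_{S^*}(x^0)$, the metric projection of $x^0$ onto the solution set $S^*$.
   Context: $\mathcal{H}$ is a real Hilbert space with inner product $\langle\cdot,\cdot\rangle$ and norm $\|\cdot\|$. For a nonempty closed convex set $S$, $P_S$ is the metric projection onto $S$. For $T:\mathcal{H}\rightrightarrows\mathcal{H}$, $\operatorname{Gph}(T)=\{(x,u):u\in T(x)\}$ and $\operatorname{dom}T=\{x:T(x)\ne\emptyset\}$. $\partial c$ is the convex subdifferential of $c$. $[t]_+=\max\{t,0\}$. Feasible set: $C=\{x\in\mathcal{H}:c(x)\le 0\}$. Solution set: $S^*$ is the set of $x^*\in C$ for which there is $u^*\in T(x^* )$ with $\langle u^*,x-x^*\rangle\ge 0$ for all $x\in C$. Normal cone: $N_C(x)=\{n:\langle n,z-x\rangle\le 0\ \forall z\in C\}$ if $x\in C$, and $N_C(x)=\emptyset$ otherwise. Minty gap: $\Phi(x)=\sup\{\langle w,x-z\rangle: z\in C,\ w\in T(z)\}\in(-\infty,+\infty]$ and $\Phi_+(x)=\max\{\Phi(x),0\}$. Assumptions. (A1) $c$ is convex and continuous,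 $C\neq\emptyset$, and for every bounded $B\subset\mathcal{H}$ there is $M_B>0$ with $\|g\|\le M_B$ for all $x\in B$ with $c(x)>0$ and all $g\in\partial c(x)$; moreover $\partial c(x)\ne\emptyset$ whenever $c(x)>0$. (A2) A fixed point $s\in\mathcal{H}$ with $c(s)<0$ is given (Slater point). (A3) $T$ is maximal monotone, $C\subseteq\operatorname{dom}T$, $S^*\neq\emptyset$, and $T+N_C$ is maximal monotone. (A4) There are $\sigma\in(0,1]$, a sequence $\varepsilon_k\ge 0$ with $\varepsilon_k\to 0$, and an oracle which for every $x^k$ returns a trial point $\widetilde y^k\in\mathcal{H}$. One sets $\lambda_k=0$ if $c(\widetilde y^k)\le 0$ and $\lambda_k=\frac{c(\widetilde y^k)}{c(\widetilde y^k)-c(s)}$ if $c(\widetilde y^k)>0$, and $y^k=(1-\lambda_k)\widetilde y^k+\lambda_k s$; the oracle then chooses $v^k\in T(y^k)$. Whenever $(x^k)$ is bounded, the sequences $(y^k)$ and $(v^k)$ are bounded and $[\langle v^k,x^k-y^k\rangle]_+\ge\sigma\Phi_+(x^k)-\varepsilon_k$ for all $k$. Algorithm FSPA. Start from $x^0\in\mathcal{H}$. For $k=0,1,2,\dots$: 1. If $c(x^k)>0$, choose $g^k\in\partial c(x^k)$ and set $C_k=\{x: c(x^k)+\langle g^k,x-x^k\rangle\le 0\}$; otherwise set $C_k=\mathcal{H}$. 2. Obtain $\widetilde y^k$, $\lambda_k$, $y^k$, $v^k\in T(y^k)$ from the oracle as in (A4), and set $H_k=\{x:\langle v^k,x-y^k\rangle\le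 0\}$. 3. Set $W_k=\{x:\langle x-x^k,x^0-x^k\rangle\le 0\}$. 4. Set $x^{k+1}=P_{C_k\cap H_k\cap W_k}(x^0)$. *)

theory Defs
  imports "HOL-Analysis.Analysis"
begin

text \<open>
  Real Hilbert spaces are types of sort \<open>{real_inner, complete_space}\<close>; set-valued operators
  are functions \<open>'a \<Rightarrow> 'a set\<close>.

  The library's \<^verbatim>\<open>closest_point\<close> requires \<^verbatim>\<open>heine_borel\<close> and hence does not apply in
  infinite dimensions, so the metric projection is introduced here. The value of
  \<open>metric_proj S a\<close> is meaningful only if \<open>S\<close> has a unique point nearest to \<open>a\<close>, which is the case
  whenever \<open>S\<close> is nonempty, closed and convex.
\<close>

definition is_metric_proj :: "'a::metric_space set \<Rightarrow> 'a \<Rightarrow> 'a \<Rightarrow> bool" where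
  "is_metric_proj S a p \<longleftrightarrow> p \<in> S \<and> (\<forall>z\<in>S. dist a p \<le> dist a z)"

definition metric_proj :: "'a::metric_space set \<Rightarrow> 'a \<Rightarrow> 'a" where
  "metric_proj S a = (THE p. is_metric_proj S a p)"

definition Gph :: "('a \<Rightarrow> 'a set) \<Rightarrow> ('a \<times> 'a) set" where
  "Gph T = {(x, u). u \<in> T x}"

definition op_dom :: "('a \<Rightarrow> 'a set) \<Rightarrow> 'a set" where
  "op_dom T = {x. T x \<noteq> {}}"

definition monotone_op :: "('a::real_inner \<Rightarrow> 'a set) \<Rightarrow> bool" where
  "monotone_op T \<longleftrightarrow> (\<forall>(x, u)\<in>Gph T. \<forall>(y, v)\<in>Gph T. 0 \<le> inner (u - v) (x - y))"

definition maximal_monotone :: "('a::real_inner \<Rightarrow> 'a set) \<Rightarrow> bool" where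
  "maximal_monotone T \<longleftrightarrow>
     monotone_op T \<and> (\<forall>S. monotone_op S \<and> Gph T \<subseteq> Gph S \<longrightarrow> Gph S = Gph T)"

definition op_sum :: "('a::plus \<Rightarrow> 'a set) \<Rightarrow> ('a \<Rightarrow> 'a set) \<Rightarrow> 'a \<Rightarrow> 'a set" where
  "op_sum A B x = {u + n | u n. u \<in> A x \<and> n \<in> B x}"

definition subdifferential :: "('a::real_inner \<Rightarrow> real) \<Rightarrow> 'a \<Rightarrow> 'a set" where
  "subdifferential c x = {g. \<forall>z. c x + inner g (z - x) \<le> c z}"

definition normal_cone :: "'a::real_inner set \<Rightarrow> 'a \<Rightarrow> 'a set" where
  "normal_cone C x = (if x \<in> C then {n. \<forall>z\<in>C. inner n (z - x) \<le> 0} else {})"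

definition feasible_set :: "('a \<Rightarrow> real) \<Rightarrow> 'a set" where
  "feasible_set c = {x. c x \<le> 0}"

definition solution_set :: "('a::real_inner \<Rightarrow> 'a set) \<Rightarrow> 'a set \<Rightarrow> 'a set" where
  "solution_set T C = {x\<in>C. \<exists>u\<in>T x. \<forall>z\<in>C. 0 \<le> inner u (z - x)}"

definition minty_gap :: "('a::real_inner \<Rightarrow> 'a set) \<Rightarrow> 'a set \<Rightarrow> 'a \<Rightarrow> ereal" where
  "minty_gap T C x = Sup {ereal (inner w (x - z)) | z w. z \<in> C \<and> w \<in> T z}"

definition minty_gap_pos :: "('a::real_inner \<Rightarrow> 'a set) \<Rightarrow> 'a set \<Rightarrow> 'a \<Rightarrow> ereal" where
  "minty_gap_pos T C x = max (minty_gap T C x) 0"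

definition slater_weight :: "('a \<Rightarrow> real) \<Rightarrow> 'a \<Rightarrow> 'a \<Rightarrow> real" where
  "slater_weight c s yt = (if c yt \<le> 0 then 0 else c yt / (c yt - c s))"

definition oracle_output ::
  "('a::real_inner \<Rightarrow> 'a set) \<Rightarrow> ('a \<Rightarrow> real) \<Rightarrow> 'a \<Rightarrow>
   (nat \<Rightarrow> 'a) \<Rightarrow> (nat \<Rightarrow> real) \<Rightarrow> (nat \<Rightarrow> 'a) \<Rightarrow> (nat \<Rightarrow> 'a) \<Rightarrow> bool" where
  "oracle_output T c s yt lam y v \<longleftrightarrow>
     (\<forall>k. lam k = slater_weight c s (yt k) \<and>
          y k = (1 - lam k) *\<^sub>R yt k + lam k *\<^sub>R s \<and>
          v k \<in> T (y k))"

definition cut_C :: "('a::real_inner \<Rightarrow> real) \<Rightarrow> 'a \<Rightarrow> 'a \<Rightarrow> 'a set" where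
  "cut_C c xk gk = (if c xk > 0 then {z. c xk + inner gk (z - xk) \<le> 0} else UNIV)"

definition cut_H :: "'a::real_inner \<Rightarrow> 'a \<Rightarrow> 'a set" where
  "cut_H yk vk = {z. inner vk (z - yk) \<le> 0}"

definition cut_W :: "'a::real_inner \<Rightarrow> 'a \<Rightarrow> 'a set" where
  "cut_W x0 xk = {z. inner (z - xk) (x0 - xk) \<le> 0}"

text \<open>
  A run of the algorithm is given by the sequences it produces; the starting point is \<open>x 0\<close>, and
  \<open>g k\<close> is unconstrained (and unused) at iterations with \<open>c (x k) \<le> 0\<close>.
\<close>

definition fspa_run ::
  "('a::real_inner \<Rightarrow> 'a set) \<Rightarrow> ('a \<Rightarrow> real) \<Rightarrow> 'a \<Rightarrow> (nat \<Rightarrow> 'a) \<Rightarrow> (nat \<Rightarrow> 'a) \<Rightarrow>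
   (nat \<Rightarrow> 'a) \<Rightarrow> (nat \<Rightarrow> real) \<Rightarrow> (nat \<Rightarrow> 'a) \<Rightarrow> (nat \<Rightarrow> 'a) \<Rightarrow> bool" where
  "fspa_run T c s x g yt lam y v \<longleftrightarrow>
     (\<forall>k. c (x k) > 0 \<longrightarrow> g k \<in> subdifferential c (x k)) \<and>
     oracle_output T c s yt lam y v \<and>
     (\<forall>k. x (Suc k) =
        metric_proj (cut_C c (x k) (g k) \<inter> cut_H (y k) (v k) \<inter> cut_W (x 0) (x k)) (x 0))"

end

theory Submission
  imports Defs
begin

text \<open>
  Maximality of \<open>T + N\<^sub>C\<close> identifies \<open>S\<^sup>*\<close> with the points of \<open>C\<close> of nonpositive Minty gap, a
  closed convex set. By induction \<open>S\<^sup>*\<close> lies in every \<open>C\<^sub>k \<inter> H\<^sub>k \<inter> W\<^sub>k\<close>, so the distances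
  of \<open>x\<^sup>k\<close> to \<open>x\<^sup>0\<close> increase and stay below the distance of \<open>x\<^sup>0\<close> to \<open>S\<^sup>*\<close>. Hence the steps
  between consecutive iterates vanish in the limit, and the cuts then make the positive parts of
  \<open>c(x\<^sup>k)\<close> and \<open>\<Phi>(x\<^sup>k)\<close> vanish too.

  Weak compactness is replaced by the closed convex hulls \<open>D\<^sub>n\<close> of the tails of the sequence: the
  projections of \<open>x\<^sup>0\<close> onto the nested sets \<open>D\<^sub>n\<close> form a Cauchy sequence. Since \<open>c\<close> and \<open>\<Phi>\<close>
  are convex and lower semicontinuous, its limit lies in \<open>S\<^sup>*\<close>; by the distance bound it is the
  projection of \<open>x\<^sup>0\<close> onto \<open>S\<^sup>*\<close>, and the parallelogram law moves \<open>x\<^sup>n\<close> to the same limit.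
\<close>

section \<open>Metric projections in Hilbert spaces\<close>

text \<open>The midpoint of \<open>p\<close> and \<open>q\<close> stays in \<open>K\<close>, so its
  distance to \<open>a\<close> is at least \<open>d\<close>; the rest is the parallelogram law.
  Almost nearest points of a convex set are therefore close to each other, which drives uniqueness,
  existence and both limit arguments for the tail hulls.\<close>

lemma convex_dist_parallelogram:
  fixes a :: "'a::real_inner"
  assumes "convex K" "p \<in> K" "q \<in> K" "0 \<le> d" "\<And>z. z \<in> K \<Longrightarrow> d \<le> dist a z"
  shows "(dist p q)\<^sup>2 \<le> 2 * (dist a p)\<^sup>2 + 2 * (dist a q)\<^sup>2 - 4 * d\<^sup>2"
proof -
  define m where "m = (1/2) *\<^sub>R p + (1/2) *\<^sub>R q"
  have "m \<in> K"
    unfolding m_def using assms(1-3) by (intro convexD) auto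
  then have "d\<^sup>2 \<le> (dist a m)\<^sup>2"
    using assms(4,5) by (intro power_mono) auto
  moreover have "(dist p q)\<^sup>2 = 2 * (dist a p)\<^sup>2 + 2 * (dist a q)\<^sup>2 - 4 * (dist a m)\<^sup>2"
    unfolding dist_norm power2_norm_eq_inner m_def
    by (simp add: inner_diff_left inner_diff_right inner_add_left inner_add_right
        inner_commute algebra_simps)
  ultimately show ?thesis by simp
qed

lemma is_metric_proj_unique:
  fixes a :: "'a::real_inner"
  assumes "convex K" "is_metric_proj K a p" "is_metric_proj K a q"
  shows "p = q"
proof -
  have "dist a p = dist a q"
    using assms(2,3) unfolding is_metric_proj_def by (meson antisym)
  then have "(dist p q)\<^sup>2 \<le> 0"
    using convex_dist_parallelogram[OF assms(1), of p q "dist a p" a] assms(2,3)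
    unfolding is_metric_proj_def by auto
  then show ?thesis by simp
qed

lemma is_metric_proj_metric_proj:
  fixes a :: "'a::{real_inner, complete_space}"
  assumes "convex K" "closed K" "K \<noteq> {}"
  shows "is_metric_proj K a (metric_proj K a)"
proof -
  define d where "d = infdist a K"
  have d0: "0 \<le> d" and dle: "\<And>z. z \<in> K \<Longrightarrow> d \<le> dist a z"
    by (auto simp: d_def infdist_nonneg infdist_le)
  have "\<exists>z\<in>K. dist a z < d + inverse (real (Suc n))" for n
    using cInf_lessD[of "dist a ` K" "d + inverse (real (Suc n))"] assms(3)
    by (auto simp: d_def infdist_notempty)
  then obtain u where u: "\<And>n. u n \<in> K" "\<And>n. dist a (u n) < d + inverse (real (Suc n))"
    by metis
  have lim: "(\<lambda>n. dist a (u n)) \<longlonglongrightarrow> d"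
    by (rule tendsto_sandwich[OF _ _ tendsto_const LIMSEQ_inverse_real_of_nat_add])
      (intro always_eventually allI dle u(1) less_imp_le[OF u(2)])+
  then have lim2: "(\<lambda>n. (dist a (u n))\<^sup>2) \<longlonglongrightarrow> d\<^sup>2"
    by (intro tendsto_power)
  \<comment> \<open>The sequence \<open>u\<close> is minimizing, so the parallelogram estimate
    bounds the squared distance of two late terms by four times the excess over the squared infimum
    \<open>d\<close>.\<close>
  have "Cauchy u"
  proof (rule metric_CauchyI)
    fix e :: real assume "e > 0"
    then have "\<forall>\<^sub>F n in sequentially. (dist a (u n))\<^sup>2 < d\<^sup>2 + e\<^sup>2 / 4"
      by (intro order_tendstoD(2)[OF lim2]) simp
    then obtain N where N: "\<And>n. n \<ge> N \<Longrightarrow> (dist a (u n))\<^sup>2 < d\<^sup>2 + e\<^sup>2 / 4"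
      by (auto simp: eventually_sequentially)
    have "dist (u m) (u n) < e" if "m \<ge> N" "n \<ge> N" for m n
    proof -
      have "(dist (u m) (u n))\<^sup>2 < e\<^sup>2"
        using convex_dist_parallelogram[OF assms(1) u(1) u(1) d0 dle, of m n] N[OF that(1)] N[OF that(2)]
        by simp
      then show ?thesis using \<open>e > 0\<close> by (simp add: power_less_imp_less_base)
    qed
    then show "\<exists>N. \<forall>m\<ge>N. \<forall>n\<ge>N. dist (u m) (u n) < e" by blast
  qed
  then obtain p where p: "u \<longlonglongrightarrow> p"
    using Cauchy_convergent_iff convergent_def by blast
  have "p \<in> K"
    using closed_sequentially[OF assms(2) _ p] u(1) by blast
  moreover have "dist a p = d"
    using LIMSEQ_unique[OF tendsto_dist[OF tendsto_const p] lim] .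
  ultimately have p: "is_metric_proj K a p"
    using dle by (simp add: is_metric_proj_def)
  show ?thesis
    unfolding metric_proj_def using p is_metric_proj_unique[OF assms(1) _ p] by (rule theI)
qed

lemma norm_minus_scaleR_squared:
  fixes e f :: "'a::real_inner"
  shows "(norm (e - t *\<^sub>R f))\<^sup>2 = (norm e)\<^sup>2 - 2 * t * inner f e + t\<^sup>2 * (norm f)\<^sup>2"
  unfolding power2_norm_eq_inner
  by (simp add: inner_diff_left inner_diff_right inner_commute power2_eq_square algebra_simps)

lemma is_metric_proj_variational:
  fixes a :: "'a::real_inner"
  assumes "convex K" "is_metric_proj K a p" "z \<in> K"
  shows "inner (z - p) (a - p) \<le> 0"
proof (rule ccontr)
  define b where "b = inner (z - p) (a - p)"
  assume "\<not> inner (z - p) (a - p) \<le> 0"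
  then have b: "b > 0" by (simp add: b_def)
  have pK: "p \<in> K" and min: "\<And>w. w \<in> K \<Longrightarrow> dist a p \<le> dist a w"
    using assms(2) by (auto simp: is_metric_proj_def)
  define n where "n = (norm (z - p))\<^sup>2"
  have "n \<ge> 0" by (simp add: n_def)
  \<comment> \<open>Moving from \<open>p\<close> towards \<open>z\<close> by \<open>t\<close>
    changes the squared distance by \<open>- 2 * t * b + t\<^sup>2 * n\<close>. This choice keeps
    \<open>t\<close> in (0,1] and makes \<open>t * (n + b) = b\<close>, so the linear gain wins,
    contradicting minimality of \<open>p\<close>.\<close>
  define t where "t = b / (n + b)"
  have t: "0 < t" "t \<le> 1" using b \<open>n \<ge> 0\<close> by (auto simp: t_def)
  have "(1 - t) *\<^sub>R p + t *\<^sub>R z \<in> K"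
    using assms(1,3) pK t by (intro convexD) auto
  then have "(dist a p)\<^sup>2 \<le> (dist a ((1 - t) *\<^sub>R p + t *\<^sub>R z))\<^sup>2"
    by (intro power_mono min) auto
  also have "\<dots> = (norm ((a - p) - t *\<^sub>R (z - p)))\<^sup>2"
    by (simp add: dist_norm algebra_simps)
  also have "\<dots> = (dist a p)\<^sup>2 - 2 * t * b + t\<^sup>2 * n"
    unfolding dist_norm b_def n_def
    by (simp add: norm_minus_scaleR_squared)
  finally have "2 * b * t \<le> (t * n) * t"
    by (simp add: power2_eq_square algebra_simps)
  then have "2 * b \<le> t * n" using t(1) by (rule mult_right_le_imp_le)
  also have "\<dots> \<le> t * (n + b)"
    using t(1) b by simp
  also have "\<dots> = b" using b \<open>n \<ge> 0\<close> by (simp add: t_def)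
  finally show False using b by simp
qed

section \<open>Convergence through the convex hulls of the tails\<close>

text \<open>Shrinking the sets can only push the nearest point away, so the squared distances are
  increasing and bounded, hence Cauchy. A later projection still lies in the earlier set, where the
  parallelogram estimate turns this into Cauchyness of \<open>p\<close>.\<close>

lemma nested_projections_converge:
  fixes a :: "'a::{real_inner, complete_space}"
  assumes convex: "\<And>n. convex (D n)" and closed: "\<And>n. closed (D n)"
    and nested: "decseq D" and proj: "\<And>n. is_metric_proj (D n) a (p n)"
    and bound: "\<And>n. dist a (p n) \<le> R"
  obtains q where "p \<longlonglongrightarrow> q" "\<And>n. q \<in> D n"
proof -
  have pD: "p m \<in> D n" if "n \<le> m" for m n
    using proj[of m] decseqD[OF nested that] by (auto simp: is_metric_proj_def)
  have min: "dist a (p n) \<le> dist a z" if "z \<in> D n" for n z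
    using proj[of n] that by (auto simp: is_metric_proj_def)
  have "incseq (\<lambda>n. (dist a (p n))\<^sup>2)"
    by (intro incseq_SucI power_mono min pD) auto
  moreover have "\<forall>n. (dist a (p n))\<^sup>2 \<le> R\<^sup>2"
    by (intro allI power_mono bound) auto
  ultimately obtain L where "(\<lambda>n. (dist a (p n))\<^sup>2) \<longlonglongrightarrow> L"
    by (rule incseq_convergent) blast
  then have C: "Cauchy (\<lambda>n. (dist a (p n))\<^sup>2)"
    using LIMSEQ_imp_Cauchy by blast
  have "Cauchy p"
  proof (rule metric_CauchyI)
    fix e :: real assume "e > 0"
    then obtain N where N: "\<And>m n. m \<ge> N \<Longrightarrow> n \<ge> N
        \<Longrightarrow> dist ((dist a (p m))\<^sup>2) ((dist a (p n))\<^sup>2) < e\<^sup>2 / 2"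
      using metric_CauchyD[OF C, of "e\<^sup>2 / 2"] by auto
    have *: "dist (p m) (p n) < e" if "n \<ge> N" "m \<ge> n" for m n
    proof -
      have "(dist (p m) (p n))\<^sup>2 \<le> 2 * (dist a (p m))\<^sup>2 + 2 * (dist a (p n))\<^sup>2 - 4 * (dist a (p n))\<^sup>2"
        using that by (intro convex_dist_parallelogram[OF convex[of n]] pD min) auto
      also have "\<dots> < e\<^sup>2"
        using N[of m n] that unfolding dist_real_def by linarith
      finally show ?thesis using \<open>e > 0\<close> by (simp add: power_less_imp_less_base)
    qed
    then have "dist (p m) (p n) < e" if "m \<ge> N" "n \<ge> N" for m n
      using that by (metis dist_commute nat_le_linear)
    then show "\<exists>N. \<forall>m\<ge>N. \<forall>n\<ge>N. dist (p m) (p n) < e" by blast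
  qed
  then obtain q where q: "p \<longlonglongrightarrow> q"
    using Cauchy_convergent_iff convergent_def by blast
  have "q \<in> D n" for n
    by (rule Lim_in_closed_set[OF closed _ _ q])
      (auto simp: eventually_sequentially intro!: exI[of _ n] pD)
  with q show ?thesis by (rule that)
qed

text \<open>The limit of the hull projections lies in \<open>S\<close> and is no farther from
  \<open>a\<close> than \<open>q\<close>, hence equals \<open>q\<close>. The distances from
  \<open>a\<close> to \<open>x n\<close> are then squeezed between those to the projections and that
  to \<open>q\<close>, which forces norm convergence.\<close>

lemma tail_hulls_imp_tendsto_metric_proj:
  fixes a :: "'a::{real_inner, complete_space}"
  assumes q: "is_metric_proj S a q" and S: "convex S"
    and bound: "\<And>n. dist a (x n) \<le> dist a q"
    and hulls: "(\<Inter>n. closure (convex hull (x ` {n..}))) \<subseteq> S"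
  shows "x \<longlonglongrightarrow> q"
proof -
  define D where "D n = closure (convex hull (x ` {n..}))" for n
  have D: "convex (D n)" "closed (D n)" for n
    by (simp_all add: D_def convex_closure)
  have xD: "x n \<in> D n" for n
    unfolding D_def by (intro subsetD[OF closure_subset] hull_inc) auto
  have "decseq D"
    unfolding D_def by (intro decseq_SucI closure_mono hull_mono image_mono) auto
  define p where "p n = metric_proj (D n) a" for n
  have proj: "is_metric_proj (D n) a (p n)" for n
    unfolding p_def using D xD by (intro is_metric_proj_metric_proj) auto
  have px: "dist a (p n) \<le> dist a (x n)" for n
    using proj[of n] xD by (auto simp: is_metric_proj_def)
  have "dist a (p n) \<le> dist a q" for n
    using px bound by (rule order_trans)
  then obtain r where r: "p \<longlonglongrightarrow> r" and rD: "\<And>n. r \<in> D n"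
    using nested_projections_converge[OF D \<open>decseq D\<close> proj] by blast
  have rS: "r \<in> S" using hulls rD by (auto simp: D_def)
  have lim: "(\<lambda>n. dist a (p n)) \<longlonglongrightarrow> dist a r"
    by (rule tendsto_dist[OF tendsto_const r])
  have "dist a r \<le> dist a q"
    using LIMSEQ_le_const2[OF lim] px bound order_trans by blast
  then have "is_metric_proj S a r"
    using q rS unfolding is_metric_proj_def by (meson order_trans)
  then have rq: "r = q" using is_metric_proj_unique[OF S _ q] by blast
  \<comment> \<open>Both points lie in \<open>D n\<close>, and \<open>p n\<close> attains the least
    distance there, so that distance serves as the lower bound in the parallelogram
    estimate.\<close>
  have le: "(dist (x n) (p n))\<^sup>2 \<le> 2 * (dist a q)\<^sup>2 - 2 * (dist a (p n))\<^sup>2" for n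
  proof -
    have "(dist (x n) (p n))\<^sup>2 \<le> 2 * (dist a (x n))\<^sup>2 + 2 * (dist a (p n))\<^sup>2 - 4 * (dist a (p n))\<^sup>2"
      using proj[of n] xD
      by (intro convex_dist_parallelogram[OF D(1)[of n]]) (auto simp: is_metric_proj_def)
    moreover have "(dist a (x n))\<^sup>2 \<le> (dist a q)\<^sup>2"
      by (intro power_mono bound) auto
    ultimately show ?thesis by linarith
  qed
  have "(\<lambda>n. 2 * (dist a q)\<^sup>2 - 2 * (dist a (p n))\<^sup>2) \<longlonglongrightarrow> 2 * (dist a q)\<^sup>2 - 2 * (dist a q)\<^sup>2"
    by (intro tendsto_diff tendsto_mult_left tendsto_power tendsto_const lim[unfolded rq])
  then have lim0: "(\<lambda>n. 2 * (dist a q)\<^sup>2 - 2 * (dist a (p n))\<^sup>2) \<longlonglongrightarrow> 0"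
    by simp
  have "(\<lambda>n. (dist (x n) (p n))\<^sup>2) \<longlonglongrightarrow> 0"
    by (rule tendsto_sandwich[OF _ _ tendsto_const lim0]) (use le in auto)
  then have "(\<lambda>n. dist (x n) (p n)) \<longlonglongrightarrow> 0"
    using tendsto_real_sqrt by fastforce
  then have "(\<lambda>n. x n - p n) \<longlonglongrightarrow> 0"
    by (simp add: dist_norm tendsto_norm_zero_iff)
  from tendsto_add[OF this r] show ?thesis by (simp add: rq)
qed

section \<open>Convex functions on the tail hulls\<close>

lemma convex_on_imp_convex_sublevel:
  assumes "convex_on UNIV f"
  shows "convex {z. f z \<le> b}"
proof (rule convexI)
  fix p q u v assume *: "p \<in> {z. f z \<le> b}" "q \<in> {z. f z \<le> b}"
    and uv: "(0::real) \<le> u" "0 \<le> v" "u + v = 1"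
  have "f (u *\<^sub>R p + v *\<^sub>R q) \<le> max (f p) (f q)"
    using convex_lower[OF assms _ _ uv] by simp
  with * show "u *\<^sub>R p + v *\<^sub>R q \<in> {z. f z \<le> b}" by auto
qed

lemma hull_tail_subset:
  assumes "closed K" "convex K" "\<forall>\<^sub>F n in sequentially. x n \<in> K"
  shows "(\<Inter>n. closure (convex hull (x ` {n..}))) \<subseteq> K"
proof -
  obtain N where "\<And>n. n \<ge> N \<Longrightarrow> x n \<in> K"
    using assms(3) by (auto simp: eventually_sequentially)
  then have "closure (convex hull (x ` {N..})) \<subseteq> K"
    using assms(1,2) by (intro closure_minimal hull_minimal) auto
  then show ?thesis by blast
qed

text \<open>For every \<open>e > 0\<close> the sublevel set at height \<open>e\<close> is closed,
  convex and contains a tail of \<open>x\<close>, hence also the closed hull of that tail. This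
  takes the place of weak lower semicontinuity.\<close>

lemma hull_tail_le:
  fixes f :: "'a::real_normed_vector \<Rightarrow> real"
  assumes f: "convex_on UNIV f" "continuous_on UNIV f"
    and b: "\<And>n. f (x n) \<le> b n" "b \<longlonglongrightarrow> 0"
    and q: "q \<in> (\<Inter>n. closure (convex hull (x ` {n..})))"
  shows "f q \<le> 0"
proof (rule field_le_epsilon)
  fix e :: real assume "e > 0"
  then have "\<forall>\<^sub>F n in sequentially. b n < e"
    using b(2) by (simp add: order_tendstoD)
  then have "\<forall>\<^sub>F n in sequentially. x n \<in> {z. f z \<le> e}"
    by eventually_elim (use b(1) in \<open>auto intro: order_trans less_imp_le\<close>)
  moreover have "closed {z. f z \<le> e}"
    using f(2) by (intro closed_Collect_le) auto
  moreover have "convex {z. f z \<le> e}"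
    using f(1) by (rule convex_on_imp_convex_sublevel)
  ultimately have "q \<in> {z. f z \<le> e}"
    by (intro subsetD[OF hull_tail_subset q])
  then show "f q \<le> 0 + e" by simp
qed

section \<open>The solution set\<close>

text \<open>Adjoining the pair \<open>(x, u)\<close> to the graph keeps it monotone, so by
  maximality the pair was already there.\<close>

lemma maximal_monotoneD:
  assumes "maximal_monotone T" "\<And>z w. w \<in> T z \<Longrightarrow> 0 \<le> inner (w - u) (z - x)"
  shows "u \<in> T x"
proof -
  define S where "S = T(x := insert u (T x))"
  have G: "Gph S = insert (x, u) (Gph T)"
    by (auto simp: S_def Gph_def split: if_splits)
  have "0 \<le> inner (u - w) (x - z)" if "w \<in> T z" for z w
    using assms(2)[OF that] by (simp add: inner_diff_left inner_diff_right algebra_simps)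
  then have "monotone_op S"
    using assms unfolding monotone_op_def G maximal_monotone_def by (auto simp: Gph_def)
  then have "Gph S = Gph T"
    using assms(1) G unfolding maximal_monotone_def by blast
  then show ?thesis using G by (auto simp: Gph_def)
qed

text \<open>Monotonicity of \<open>T\<close> gives one inclusion, maximality of the sum the other.
  The right-hand side is an intersection of \<open>C\<close> with half-spaces, which shows
  closedness and convexity and later places solutions inside every \<open>cut_H\<close>.\<close>

lemma solution_set_eq_Minty:
  assumes "monotone_op T" "maximal_monotone (op_sum T (normal_cone C))"
  shows "solution_set T C = C \<inter> (\<Inter>z\<in>C. \<Inter>w\<in>T z. {p. inner w (p - z) \<le> 0})"
proof (intro equalityI subsetI)
  fix p assume "p \<in> solution_set T C"
  then obtain u where p: "p \<in> C" "u \<in> T p" and u: "\<And>z. z \<in> C \<Longrightarrow> 0 \<le> inner u (z - p)"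
    by (auto simp: solution_set_def)
  have "inner w (p - z) \<le> 0" if "z \<in> C" "w \<in> T z" for z w
  proof -
    have "0 \<le> inner (w - u) (z - p)"
      using assms(1) p that by (auto simp: monotone_op_def Gph_def)
    with u[OF that(1)] show ?thesis
      by (simp add: inner_diff_left inner_diff_right)
  qed
  with p show "p \<in> C \<inter> (\<Inter>z\<in>C. \<Inter>w\<in>T z. {p. inner w (p - z) \<le> 0})" by auto
next
  fix p assume p: "p \<in> C \<inter> (\<Inter>z\<in>C. \<Inter>w\<in>T z. {p. inner w (p - z) \<le> 0})"
  \<comment> \<open>The pair \<open>(p, 0)\<close> is monotonically related to the graph of the sum:
    the Minty inequality handles the part from \<open>T\<close>, and normality at \<open>z\<close>
    tested with \<open>p\<close> handles the part from the cone.\<close>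
  have "0 \<in> op_sum T (normal_cone C) p"
  proof (rule maximal_monotoneD[OF assms(2)])
    fix z w' assume "w' \<in> op_sum T (normal_cone C) z"
    then obtain w n where "w' = w + n" "w \<in> T z" "z \<in> C" "inner n (p - z) \<le> 0"
      using p by (auto simp: op_sum_def normal_cone_def split: if_splits)
    moreover from this have "inner w (p - z) \<le> 0" using p by auto
    ultimately show "0 \<le> inner (w' - 0) (z - p)"
      by (simp add: inner_diff_right inner_add_left)
  qed
  then obtain u n where un: "u \<in> T p" "n \<in> normal_cone C p" "u + n = 0"
    by (auto simp: op_sum_def)
  then have "n = - u" by (simp add: eq_neg_iff_add_eq_0 add.commute)
  then have "\<forall>z\<in>C. 0 \<le> inner u (z - p)"
    using un(2) p by (auto simp: normal_cone_def)
  then show "p \<in> solution_set T C"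
    using p un(1) by (auto simp: solution_set_def)
qed

section \<open>Half-spaces, oracle points and steps of the algorithm\<close>

lemma closed_halfspace_inner_diff: "closed {p::'a::real_inner. inner w (p - z) \<le> 0}"
  by (intro closed_Collect_le continuous_intros)

lemma convex_halfspace_inner_diff: "convex {p::'a::real_inner. inner w (p - z) \<le> b}"
proof -
  have "{p. inner w (p - z) \<le> b} = {p. inner w p \<le> b + inner w z}"
    by (auto simp: inner_diff_right)
  then show ?thesis by (simp add: convex_halfspace_le)
qed

lemma closed_cut_C: "closed (cut_C c xk gk)"
  unfolding cut_C_def by (auto intro!: closed_Collect_le continuous_intros)

lemma convex_cut_C: "convex (cut_C c xk gk)"
proof -
  have "{z. c xk + inner gk (z - xk) \<le> 0} = {z. inner gk (z - xk) \<le> - c xk}" by auto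
  then show ?thesis by (simp add: cut_C_def convex_halfspace_inner_diff)
qed

text \<open>For infeasible \<open>yt\<close> the weight is the zero of the affine interpolation
  between \<open>c yt\<close> and \<open>c s\<close>, and convexity keeps \<open>c\<close> below
  that interpolation.\<close>

lemma slater_point_feasible:
  fixes c :: "'a::real_vector \<Rightarrow> real"
  assumes "convex_on UNIV c" "c s < 0" "l = slater_weight c s yt"
  shows "c ((1 - l) *\<^sub>R yt + l *\<^sub>R s) \<le> 0"
proof (cases "c yt \<le> 0")
  case True
  with assms(3) show ?thesis by (simp add: slater_weight_def)
next
  case False
  then have l: "l = c yt / (c yt - c s)" using assms(3) by (simp add: slater_weight_def)
  have "0 \<le> l" "l \<le> 1" using False assms(2) by (auto simp: l)
  then have "c ((1 - l) *\<^sub>R yt + l *\<^sub>R s) \<le> (1 - l) * c yt + l * c s"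
    using convex_onD[OF assms(1)] by blast
  also have "\<dots> = c yt - l * (c yt - c s)" by (simp add: algebra_simps)
  also have "\<dots> = 0" using False assms(2) by (simp add: l)
  finally show ?thesis .
qed

lemma inner_le_minty_gap_pos:
  assumes "z \<in> C" "w \<in> T z"
  shows "ereal (inner w (p - z)) \<le> minty_gap_pos T C p"
proof -
  have "ereal (inner w (p - z)) \<le> minty_gap T C p"
    unfolding minty_gap_def using assms by (intro Sup_upper) auto
  then show ?thesis unfolding minty_gap_pos_def by (rule max.coboundedI1)
qed

text \<open>The cut \<open>cut_W\<close> makes the angle at \<open>x k\<close> obtuse, so the
  squared step is at most the increment of the squared distance to \<open>a\<close>. These distances
  increase and are bounded, so their increments tend to zero.\<close>

lemma outer_projection_steps_vanish:
  fixes a :: "'a::real_inner"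
  assumes "\<And>k. x (Suc k) \<in> cut_W a (x k)" "\<And>k. dist a (x k) \<le> R"
  shows "(\<lambda>k. dist (x k) (x (Suc k))) \<longlonglongrightarrow> 0"
proof -
  let ?d = "\<lambda>k. (dist a (x k))\<^sup>2"
  have step: "(dist (x k) (x (Suc k)))\<^sup>2 \<le> ?d (Suc k) - ?d k" for k
  proof -
    have "?d (Suc k) - ?d k - (dist (x k) (x (Suc k)))\<^sup>2 = - 2 * inner (x (Suc k) - x k) (a - x k)"
      unfolding dist_norm power2_norm_eq_inner
      by (simp add: inner_diff_left inner_diff_right inner_commute algebra_simps)
    with assms(1)[of k] show ?thesis by (simp add: cut_W_def)
  qed
  have "incseq ?d"
    using step by (intro incseq_SucI) (smt (verit) zero_le_power2)
  moreover have "\<forall>k. ?d k \<le> R\<^sup>2"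
    by (intro allI power_mono assms(2)) auto
  ultimately obtain L where L: "?d \<longlonglongrightarrow> L"
    by (rule incseq_convergent) blast
  have lim: "(\<lambda>k. ?d (Suc k) - ?d k) \<longlonglongrightarrow> 0"
    using tendsto_diff[OF LIMSEQ_Suc[OF L] L] by simp
  have "(\<lambda>k. (dist (x k) (x (Suc k)))\<^sup>2) \<longlonglongrightarrow> 0"
    by (rule tendsto_sandwich[OF _ _ tendsto_const lim]) (use step in auto)
  then show ?thesis using tendsto_real_sqrt by fastforce
qed

theorem theorem4p1:
  fixes T :: "'a::{real_inner, complete_space} \<Rightarrow> 'a set"
    and c :: "'a \<Rightarrow> real"
    and C :: "'a set"
    and s x0 :: 'a
    and \<sigma> :: real
    and \<epsilon> lam :: "nat \<Rightarrow> real"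
    and x g yt y v :: "nat \<Rightarrow> 'a"
  assumes C_def: "C = feasible_set c"
    and A1_convex: "convex_on UNIV c"
    and A1_cont: "continuous_on UNIV c"
    and A1_nonempty: "C \<noteq> {}"
    and A1_bounded: "\<And>B. bounded B \<Longrightarrow>
          \<exists>M>0. \<forall>z\<in>B. c z > 0 \<longrightarrow> (\<forall>h\<in>subdifferential c z. norm h \<le> M)"
    and A1_subdiff: "\<And>z. c z > 0 \<Longrightarrow> subdifferential c z \<noteq> {}"
    and A2: "c s < 0"
    and A3_max: "maximal_monotone T"
    and A3_dom: "C \<subseteq> op_dom T"
    and A3_sol: "solution_set T C \<noteq> {}"
    and A3_sum: "maximal_monotone (op_sum T (normal_cone C))"
    and A4_sigma: "0 < \<sigma>" "\<sigma> \<le> 1"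
    and A4_eps: "\<And>k. 0 \<le> \<epsilon> k" "\<epsilon> \<longlonglongrightarrow> 0"
    and A4_oracle: "bounded (range x) \<Longrightarrow>
          bounded (range y) \<and> bounded (range v) \<and>
          (\<forall>k. ereal (max (inner (v k) (x k - y k)) 0)
                 \<ge> ereal \<sigma> * minty_gap_pos T C (x k) - ereal (\<epsilon> k))"
    and start: "x 0 = x0"
    and run: "fspa_run T c s x g yt lam y v"
  shows "is_metric_proj (solution_set T C) x0 (metric_proj (solution_set T C) x0) \<and>
         x \<longlonglongrightarrow> metric_proj (solution_set T C) x0"
proof -

  \<comment> \<open>The solution set and its projection\<close>
  define S where "S = solution_set T C"
  have cconv: "convex C"
    using A1_convex unfolding C_def feasible_set_def by (rule convex_on_imp_convex_sublevel)
  have cclosed: "closed C"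
    using A1_cont unfolding C_def feasible_set_def by (intro closed_Collect_le) auto
  have mono: "monotone_op T" using A3_max by (simp add: maximal_monotone_def)
  note Minty = solution_set_eq_Minty[OF mono A3_sum, folded S_def]
  have S: "convex S" "closed S"
    unfolding Minty using cconv cclosed
    by (auto intro!: convex_Int convex_INT closed_Int closed_INT
        closed_halfspace_inner_diff convex_halfspace_inner_diff)
  have Sne: "S \<noteq> {}" using A3_sol by (simp add: S_def)
  define q where "q = metric_proj S x0"
  have q: "is_metric_proj S x0 q"
    unfolding q_def by (rule is_metric_proj_metric_proj[OF S Sne])
  have qS: "q \<in> S" using q by (simp add: is_metric_proj_def)

  \<comment> \<open>Solutions survive all cuts; the iterates are bounded\<close>
  define K where "K k = cut_C c (x k) (g k) \<inter> cut_H (y k) (v k) \<inter> cut_W x0 (x k)" for k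
  have g: "\<And>k. c (x k) > 0 \<Longrightarrow> g k \<in> subdifferential c (x k)"
    and xSuc: "\<And>k. x (Suc k) = metric_proj (K k) x0"
    using run start by (auto simp: fspa_run_def K_def)
  have "oracle_output T c s yt lam y v"
    using run by (simp add: fspa_run_def)
  then have lam: "\<And>k. lam k = slater_weight c s (yt k)"
    and y: "\<And>k. y k = (1 - lam k) *\<^sub>R yt k + lam k *\<^sub>R s" and v: "\<And>k. v k \<in> T (y k)"
    unfolding oracle_output_def by blast+
  have yC: "y k \<in> C" for k
    using slater_point_feasible[OF A1_convex A2 lam] by (simp add: C_def feasible_set_def y)
  have Kconv: "convex (K k)" and Kclosed: "closed (K k)" for k
    unfolding K_def cut_H_def cut_W_def inner_commute[of "_ - x k" "x0 - x k"]
    by (intro convex_Int closed_Int convex_cut_C closed_cut_C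
        convex_halfspace_inner_diff closed_halfspace_inner_diff)+
  have SC: "S \<subseteq> cut_C c (x k) (g k)" for k
  proof
    fix z assume "z \<in> S"
    then have "c z \<le> 0" by (simp add: S_def solution_set_def C_def feasible_set_def)
    then show "z \<in> cut_C c (x k) (g k)"
      using g[of k] by (auto simp: cut_C_def subdifferential_def intro: order_trans)
  qed
  have SH: "S \<subseteq> cut_H (y k) (v k)" for k
    using yC[of k] v[of k] by (auto simp: Minty cut_H_def)
  have SK: "S \<subseteq> K k" for k
  proof (induction k)
    case 0
    have "cut_W x0 (x 0) = UNIV" by (simp add: cut_W_def start)
    then show ?case using SC SH by (simp add: K_def)
  next
    case (Suc k)
    \<comment> \<open>The induction hypothesis makes \<open>K k\<close> nonempty, so the projection
      exists; its variational inequality, tested with points of \<open>S\<close>, is exactly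
      membership in the next \<open>cut_W\<close>.\<close>
    have "is_metric_proj (K k) x0 (x (Suc k))"
      unfolding xSuc using Kconv Kclosed Suc Sne by (intro is_metric_proj_metric_proj) auto
    then have "S \<subseteq> cut_W x0 (x (Suc k))"
      using is_metric_proj_variational[OF Kconv _ subsetD[OF Suc]] by (auto simp: cut_W_def)
    then show ?case using SC SH by (simp add: K_def)
  qed
  have proj: "is_metric_proj (K k) x0 (x (Suc k))" for k
    unfolding xSuc using SK[of k] Sne by (intro is_metric_proj_metric_proj Kconv Kclosed) auto
  then have xK: "x (Suc k) \<in> K k" for k by (simp add: is_metric_proj_def)
  have dist_le: "dist x0 (x k) \<le> dist x0 q" for k
  proof (cases k)
    case 0
    then show ?thesis by (simp add: start)
  next
    case (Suc j)
    then show ?thesis using proj[of j] subsetD[OF SK[of j] qS] by (auto simp: is_metric_proj_def)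
  qed
  have steps: "(\<lambda>k. dist (x k) (x (Suc k))) \<longlonglongrightarrow> 0"
    using xK dist_le by (intro outer_projection_steps_vanish) (auto simp: K_def)
  have bdd: "bounded (range x)"
    using dist_le unfolding bounded_def by blast
  note oracle_bounds = A4_oracle[OF bdd]
  obtain Mv where Mv: "\<And>k. norm (v k) \<le> Mv"
    using oracle_bounds by (auto simp: bounded_iff)
  obtain M where M: "M > 0" "\<And>k h. c (x k) > 0 \<Longrightarrow> h \<in> subdifferential c (x k) \<Longrightarrow> norm h \<le> M"
    using A1_bounded[OF bdd] by blast

  \<comment> \<open>Points common to all tail hulls are solutions\<close>
  have hulls: "(\<Inter>n. closure (convex hull (x ` {n..}))) \<subseteq> S"
  proof
    fix r assume r: "r \<in> (\<Inter>n. closure (convex hull (x ` {n..})))"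
    \<comment> \<open>The next iterate satisfies the constraint linearized at \<open>x k\<close>, so
      a positive violation is at most the subgradient bound times the step length.\<close>
    have "c (x k) \<le> M * dist (x k) (x (Suc k))" for k
    proof (cases "c (x k) > 0")
      case True
      have "c (x k) \<le> inner (g k) (x k - x (Suc k))"
        using xK[of k] True by (simp add: K_def cut_C_def inner_diff_right)
      also have "\<dots> \<le> norm (g k) * norm (x k - x (Suc k))" by (rule norm_cauchy_schwarz)
      also have "\<dots> \<le> M * dist (x k) (x (Suc k))"
        unfolding dist_norm using M(2)[OF True g[OF True]] by (rule mult_right_mono) simp
      finally show ?thesis .
    next
      case False
      then show ?thesis using M(1) by (smt (verit) mult_nonneg_nonneg zero_le_dist)
    qed
    moreover have "(\<lambda>k. M * dist (x k) (x (Suc k))) \<longlonglongrightarrow> 0"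
      using tendsto_mult_right_zero[OF steps] .
    ultimately have "c r \<le> 0"
      by (rule hull_tail_le[OF A1_convex A1_cont _ _ r])
    \<comment> \<open>The gap may be infinite, so it is replaced by one real-valued affine minorant
      per pair \<open>z\<close>, \<open>w\<close>; these suffice for the Minty description of
      \<open>S\<close>.\<close>
    moreover have "inner w (r - z) \<le> 0" if "z \<in> C" "w \<in> T z" for z w
    proof -
      let ?f = "\<lambda>p. inner w (p - z)"
      have gap: "?f (x k) \<le> (Mv * dist (x k) (x (Suc k)) + \<epsilon> k) / \<sigma>" for k
      proof -
        \<comment> \<open>Membership of the next iterate in \<open>cut_H\<close> bounds the oracle's
          inner product by \<open>Mv\<close> times the step length; the oracle inequality then
          carries this bound over to the gap.\<close>
        have "inner (v k) (x k - y k) \<le> inner (v k) (x k - x (Suc k))"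
          using xK[of k] by (simp add: K_def cut_H_def inner_diff_right)
        also have "\<dots> \<le> norm (v k) * norm (x k - x (Suc k))" by (rule norm_cauchy_schwarz)
        also have "\<dots> \<le> Mv * dist (x k) (x (Suc k))"
          unfolding dist_norm using Mv by (rule mult_right_mono) simp
        finally have le: "max (inner (v k) (x k - y k)) 0 \<le> Mv * dist (x k) (x (Suc k))"
          using order_trans[OF norm_ge_zero Mv] by simp
        have "ereal \<sigma> * ereal (?f (x k)) \<le> ereal \<sigma> * minty_gap_pos T C (x k)"
          using A4_sigma(1) by (intro ereal_mult_left_mono inner_le_minty_gap_pos that) simp
        then have "ereal (\<sigma> * ?f (x k)) - ereal (\<epsilon> k) \<le> ereal \<sigma> * minty_gap_pos T C (x k) - ereal (\<epsilon> k)"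
          by (intro ereal_minus_mono) auto
        also have "\<dots> \<le> ereal (max (inner (v k) (x k - y k)) 0)"
          using oracle_bounds by blast
        also have "\<dots> \<le> ereal (Mv * dist (x k) (x (Suc k)))"
          unfolding ereal_less_eq by (rule le)
        finally have "\<sigma> * ?f (x k) - \<epsilon> k \<le> Mv * dist (x k) (x (Suc k))"
          by simp
        then show ?thesis using A4_sigma(1) by (simp add: pos_le_divide_eq mult.commute)
      qed
      have "(\<lambda>k. (Mv * dist (x k) (x (Suc k)) + \<epsilon> k) / \<sigma>) \<longlonglongrightarrow> (Mv * 0 + 0) / \<sigma>"
        using A4_sigma(1) by (intro tendsto_intros steps A4_eps) auto
      then have lim: "(\<lambda>k. (Mv * dist (x k) (x (Suc k)) + \<epsilon> k) / \<sigma>) \<longlonglongrightarrow> 0" by simp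
      have "convex_on UNIV ?f"
        by (rule convex_onI) (auto simp: algebra_simps inner_diff_right inner_add_right)
      moreover have "continuous_on UNIV ?f" by (intro continuous_intros)
      ultimately show ?thesis by (rule hull_tail_le[OF _ _ gap lim r])
    qed
    ultimately show "r \<in> S" by (auto simp: Minty C_def feasible_set_def)
  qed
  have "x \<longlonglongrightarrow> q"
    by (rule tail_hulls_imp_tendsto_metric_proj[OF q S(1) dist_le hulls])
  with q show ?thesis by (simp add: q_def S_def)
qed

end
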